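(* Let $X,Y$ be real normed spaces, $\Omega\subset X$ a nonempty set, $f:\Omega\to Y$ a map, and $\mathcal K\subset Y$ a co-radiant set. Let $\varepsilon>0$ and $\bar x\in\Omega$. If $$\phi_{\mathcal K}\bigl(f(\bar x)-f(x)\bigr)<\varepsilon\qquad\forall x\in\Omega,$$ then $\bar x$ is $\mathcal K(\varepsilon)$-approximately efficient.
   Context: $S_Y$ is the unit sphere of $Y$. A co-radiant set is $\mathcal K\subset Y$ with $\lambda y\in\mathcal K$ for all $y\in\mathcal K$, $\lambda\ge 1$; co-radiant sets are assumed nonempty with $0_Y\notin\mathcal K$. For $\varepsilon>0$, $\mathcal K(\varepsilon):=\varepsilon\mathcal K$. A point $\bar x\in\Omega$ is $\mathcal K(\varepsilon)$-approximately efficient if $f(\Omega)\cap(f(\bar x)-\mathcal K(\varepsilon))=\varnothing$, equivalently $f(\bar x)-f(x)\notin\mathcal K(\varepsilon)$ for all $x\in\Omega$. Radial profile: $\rho_{\mathcal K}:S_Y\to[0,+\infty]$, $\rho_{\mathcal K}(v):=\inf\{\lambda>0:\lambda v\in\mathcal K\}$ with $\inf\varnothing=+\infty$. $\phi_{\mathcal K}:Y\to[0,+\infty]$ is defined by $\phi_{\mathcal K}(0_Y):=0$ and $\phi_{\mathcal K}(y):=\|y\|/\rho_{\mathcal K}(y/\|y\|)$ for $y\ne 0_Y$, with the conventions $a/(+\infty):=0$ and $a/0:=+\infty$ for $a>0$. *)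

theory Defs
  imports "HOL-Analysis.Analysis"
begin

definition co_radiant :: "'b::real_normed_vector set \<Rightarrow> bool" where
  "co_radiant K \<longleftrightarrow>
     K \<noteq> {} \<and> 0 \<notin> K \<and> (\<forall>y\<in>K. \<forall>l::real. 1 \<le> l \<longrightarrow> l *\<^sub>R y \<in> K)"

definition dilate :: "'b::real_normed_vector set \<Rightarrow> real \<Rightarrow> 'b set" where
  "dilate K e = (\<lambda>y. e *\<^sub>R y) ` K"

definition approx_efficient ::
    "'a set \<Rightarrow> ('a \<Rightarrow> 'b::real_normed_vector) \<Rightarrow> 'b set \<Rightarrow> real \<Rightarrow> 'a \<Rightarrow> bool" where
  "approx_efficient \<Omega> f K e xbar \<longleftrightarrow>
     xbar \<in> \<Omega> \<and> f ` \<Omega> \<inter> (\<lambda>k. f xbar - k) ` dilate K e = {}"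

(* Only meaningful for v on the unit sphere.  The infimum is taken in ennreal, where
   Inf {} = top = \<infinity>. *)
definition radial_profile :: "'b::real_normed_vector set \<Rightarrow> 'b \<Rightarrow> ennreal" where
  "radial_profile K v = Inf {ennreal l | l :: real. l > 0 \<and> l *\<^sub>R v \<in> K}"

(* Division on ennreal satisfies a / \<infinity> = 0 and a / 0 = \<infinity> for real a > 0; see the two
   lemmas below. *)
definition phi :: "'b::real_normed_vector set \<Rightarrow> 'b \<Rightarrow> ennreal" where
  "phi K y = (if y = 0 then 0 else ennreal (norm y) / radial_profile K (y /\<^sub>R norm y))"

lemma ennreal_pos_divide_infinity: "ennreal a / \<infinity> = 0" for a :: real
  by simp

lemma ennreal_pos_divide_zero: "a > 0 \<Longrightarrow> ennreal a / 0 = \<infinity>" for a :: real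
  by (simp add: ennreal_divide_zero)

end

theory Submission
  imports Defs
begin

text \<open>
  A point \<open>\<epsilon> k\<close> with \<open>k \<in> K\<close> lies on the ray through \<open>k\<close>, and that ray meets \<open>K\<close> no later than
  at \<open>k\<close> itself, so the radial profile in this direction is at most \<open>norm k\<close>. Dividing
  \<open>norm (\<epsilon> k) = \<epsilon> norm k\<close> by it gives at least \<open>\<epsilon>\<close>: the function \<open>phi\<close> is bounded below by \<open>\<epsilon>\<close> on
  the dilated set (lemma \<open>phi_ge_on_dilate\<close>). Hence \<open>phi < \<epsilon>\<close> at all differences
  \<open>f xbar - f x\<close> keeps them out of that set, which is approximate efficiency.
\<close>

lemma ennreal_inverse_antimono:
  fixes a b :: ennreal
  assumes "a \<le> b"
  shows "inverse b \<le> inverse a"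
  using assms
  by (simp add: less_eq_ennreal.rep_eq inverse_ennreal.rep_eq ereal_inverse_antimono)

lemma radial_profile_le_norm:
  assumes "k \<in> K" "k \<noteq> 0"
  shows "radial_profile K (k /\<^sub>R norm k) \<le> ennreal (norm k)"
  unfolding radial_profile_def
  using assms by (intro Inf_lower) (auto intro!: exI[of _ "norm k"])

text \<open>
  The profile in the direction of \<open>y = e k\<close> is at most \<open>norm k\<close>, and division is antitone in the
  divisor. Since antitonicity holds on all extended nonnegative reals, a vanishing profile, where
  \<open>phi\<close> is infinite, is included.
\<close>

lemma phi_ge_on_dilate:
  assumes "0 \<notin> K" "e > 0" "y \<in> dilate K e"
  shows "ennreal e \<le> phi K y"
proof -
  obtain k where k: "k \<in> K" "y = e *\<^sub>R k"
    using assms(3) by (auto simp: dilate_def)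
  have k0: "k \<noteq> 0"
    using assms(1) k(1) by auto
  have direction: "y /\<^sub>R norm y = k /\<^sub>R norm k"
    using assms(2) k(2) by simp
  have "ennreal e = ennreal (norm y) / ennreal (norm k)"
    using assms(2) k(2) k0 by (simp add: divide_ennreal)
  also have "\<dots> \<le> ennreal (norm y) / radial_profile K (y /\<^sub>R norm y)"
    unfolding direction divide_ennreal_def
    by (intro mult_left_mono ennreal_inverse_antimono radial_profile_le_norm k k0) simp
  also have "\<dots> = phi K y"
    using assms(2) k(2) k0 by (simp add: phi_def)
  finally show ?thesis .
qed

theorem proposition5p18:
  fixes \<Omega> :: "'a::real_normed_vector set"
    and f :: "'a \<Rightarrow> 'b::real_normed_vector"
    and K :: "'b set"
    and \<epsilon> :: real
    and xbar :: 'a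
  assumes "\<Omega> \<noteq> {}"
    and "co_radiant K"
    and "\<epsilon> > 0"
    and "xbar \<in> \<Omega>"
    and "\<forall>x\<in>\<Omega>. phi K (f xbar - f x) < ennreal \<epsilon>"
  shows "approx_efficient \<Omega> f K \<epsilon> xbar"
proof -
  have K0: "0 \<notin> K"
    using assms(2) by (simp add: co_radiant_def)
  have "f x \<noteq> f xbar - d" if "x \<in> \<Omega>" "d \<in> dilate K \<epsilon>" for x d
  proof
    assume "f x = f xbar - d"
    then have "f xbar - f x = d"
      by simp
    then show False
      using assms(5) that(1) phi_ge_on_dilate[OF K0 assms(3) that(2)] by (metis not_le)
  qed
  then show ?thesis
    using assms(4) by (auto simp: approx_efficient_def)
qed

end
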